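(* Let $A\subset C$ and $B\subset D$ be unital inclusions of unital $C^*$-algebras which are strongly Morita equivalent with respect to a $C-D$-equivalence bimodule $Y$ and its closed subspace $X$. Let $E^A:C\to A$ and $E^B:D\to B$ be conditional expectations of Watatani index-finite type and let $E^X$ be a conditional expectation from $Y$ onto $X$ with respect to $E^A$ and $E^B$. Let $C_1$ and $D_1$ be the $C^*$-basic constructions for $E^A$ and $E^B$, let $Y_1=C\otimes_A X\otimes_B\widetilde{D}$, and regard $Y$ as a closed subspace of $Y_1$ via the linear map $$\phi:Y\to Y_1,\qquad \phi(y)=\sum_{i,j}u_i\otimes E^X(u_i^*\cdot y\cdot v_j)\otimes\widetilde{v_j},$$ where $\{(u_i,u_i^* )\}$ and $\{(v_j,v_j^* )\}$ are quasi-bases for $E^A$ and $E^B$. Then the inclusions $C\subset C_1$ and $D\subset D_1$ are strongly Morita equivalent with respect to the $C_1-D_1$-equivalence bimodule $Y_1$ and its closed subspace $Y$.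
   Context: Equivalence bimodules are imprimitivity bimodules; actions are written $c\cdot y$, $y\cdot d$; ${}_C\langle\ ,\ \rangle$ (linear in the first variable) and $\langle\ ,\ \rangle_D$ (linear in the second variable) are the inner products. For sets, $\langle U,V\rangle$ means the linear span of the inner products. Strong Morita equivalence of inclusions: unital inclusions $A\subset C$, $B\subset D$ are strongly Morita equivalent with respect to a $C-D$-equivalence bimodule $Y$ and its closed subspace $X$ if (1) $a\cdot x\in X$ and ${}_C\langle x,y\rangle\in A$ for $a\in A$, $x,y\in X$, and $\overline{{}_C\langle X,X\rangle}=A$, $\overline{{}_C\langle Y,X\rangle}=C$; (2) $x\cdot b\in X$ and $\langle x,y\rangle_D\in B$ for $b\in B$, $x,y\in X$, and $\overline{\langle X,X\rangle_D}=B$, $\overline{\langle Y,X\rangle_D}=D$. Then $X$ is an $A-B$-equivalence bimodule. A linear map $E^X$ from $Y$ onto $X$ is a conditional expectation with respect to $E^A$ and $E^B$ if, for all $a\in A,b\in B,c\in C,d\in D,x\in X,y\in Y$: $E^X(c\cdot x)=E^A(c)\cdot x$; $E^X(a\cdot y)=a\cdot E^X(y)$; $E^A({}_C\langle y,x\rangle)={}_C\langle E^X(y),x\rangle$; $E^X(x\cdot d)=x\cdot E^B(d)$; $E^X(y\cdot b)=E^X(y)\cdot b$; $E^B(\langle y,x\rangle_D)=\langle E^X(y),x\rangle_D$. $E^A$ is of Watatani index-finite type if it has a quasi-basis: a finite family $\{(u_i,u_i^* )\}$ with $u_i\in C$ and $\sum_i u_iE^A(u_i^*c)=c=\sum_i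 E^A(cu_i)u_i^*$ for all $c\in C$. The $C^*$-basic construction $C_1$ for $E^A$, with Jones projection $e_A$, is the linear span of $\{c_1e_Ac_2: c_1,c_2\in C\}$, where $e_Ace_A=E^A(c)e_A$. $C$ is a $C_1-A$-equivalence bimodule via ${}_{C_1}\langle x,y\rangle=xe_Ay^*$, $\langle x,y\rangle_A=E^A(x^*y)$, $(xe_Ay)\cdot z=xE^A(yz)$, $x\cdot a=xa$. Likewise $D$ is a $D_1-B$-equivalence bimodule (Jones projection $e_B$), and $\widetilde{D}=\{\widetilde d: d\in D\}$ is its dual $B-D_1$-equivalence bimodule. The map $\phi$ is $C-D$-bilinear, preserves inner products, and does not depend on the choice of quasi-bases. *)

theory Defs
  imports "HOL-Analysis.Analysis"
begin

section \<open>Complex Banach spaces and unital C*-algebras\<close>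

class complex_vector = ab_group_add +
  fixes scaleC :: "complex \<Rightarrow> 'a \<Rightarrow> 'a"  (infixr \<open>*\<^sub>C\<close> 75)
  assumes scaleC_add_right: "s *\<^sub>C (x + y) = s *\<^sub>C x + s *\<^sub>C y"
    and scaleC_add_left: "(r + s) *\<^sub>C x = r *\<^sub>C x + s *\<^sub>C x"
    and scaleC_scaleC: "r *\<^sub>C s *\<^sub>C x = (r * s) *\<^sub>C x"
    and scaleC_one: "1 *\<^sub>C x = x"

global_interpretation complex_vector: vector_space "scaleC :: complex \<Rightarrow> 'a \<Rightarrow> 'a::complex_vector"
  defines cspan = complex_vector.span
    and csubspace = complex_vector.subspace
  by unfold_locales (rule scaleC_add_right scaleC_add_left scaleC_scaleC scaleC_one)+

abbreviation clinear :: "('a::complex_vector \<Rightarrow> 'b::complex_vector) \<Rightarrow> bool"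
  where "clinear \<equiv> Vector_Spaces.linear scaleC scaleC"

class complex_banach = complex_vector + banach +
  assumes scaleR_scaleC: "scaleR r x = complex_of_real r *\<^sub>C x"
    and norm_scaleC: "norm (s *\<^sub>C x) = cmod s * norm x"

text \<open>The class is built on \<^class>\<open>monoid_mult\<close> rather than \<^class>\<open>real_normed_algebra_1\<close>,
  which would impose \<open>0 \<noteq> 1\<close>: the zero algebra is allowed.\<close>

class unital_cstar_algebra = complex_banach + real_normed_algebra + monoid_mult +
  fixes star :: "'a \<Rightarrow> 'a"
  assumes mult_scaleC_left: "(s *\<^sub>C x) * y = s *\<^sub>C (x * y)"
    and mult_scaleC_right: "x * (s *\<^sub>C y) = s *\<^sub>C (x * y)"
    and star_add: "star (x + y) = star x + star y"
    and star_scaleC: "star (s *\<^sub>C x) = cnj s *\<^sub>C star x"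
    and star_mult: "star (x * y) = star y * star x"
    and star_star: "star (star x) = x"
    and cstar_identity: "norm (star x * x) = (norm x)\<^sup>2"

locale unital_cstar_subalgebra =
  fixes A :: "'c::unital_cstar_algebra set"
  assumes closed: "closed A"
    and subspace: "csubspace A"
    and one_mem: "1 \<in> A"
    and mult_mem: "a \<in> A \<Longrightarrow> b \<in> A \<Longrightarrow> a * b \<in> A"
    and star_mem: "a \<in> A \<Longrightarrow> star a \<in> A"

definition positive_in :: "'c::unital_cstar_algebra set \<Rightarrow> 'c \<Rightarrow> bool"
  where "positive_in A x \<longleftrightarrow> (\<exists>a\<in>A. x = star a * a)"

text \<open>An inclusion of C*-algebras \<open>C \<subset> C\<^sub>1\<close> is given by a map \<open>\<iota>\<close> of types. For *-homomorphisms
  of C*-algebras, being isometric is the same as being injective.\<close>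

locale unital_cstar_embedding =
  fixes \<iota> :: "'c::unital_cstar_algebra \<Rightarrow> 'e::unital_cstar_algebra"
  assumes linear: "clinear \<iota>"
    and mult: "\<iota> (x * y) = \<iota> x * \<iota> y"
    and one: "\<iota> 1 = 1"
    and star: "\<iota> (star x) = star (\<iota> x)"
    and isometric: "norm (\<iota> x) = norm x"


section \<open>Equivalence bimodules\<close>

record ('p, 'q, 'm) bimod =
  lact :: "'p \<Rightarrow> 'm \<Rightarrow> 'm"
  ract :: "'m \<Rightarrow> 'q \<Rightarrow> 'm"
  lip :: "'m \<Rightarrow> 'm \<Rightarrow> 'p"
  rip :: "'m \<Rightarrow> 'm \<Rightarrow> 'q"

text \<open>An equivalence bimodule carries two module norms, \<open>\<parallel>lip x x\<parallel>\<^sup>1\<^sup>/\<^sup>2\<close> and \<open>\<parallel>rip x x\<parallel>\<^sup>1\<^sup>/\<^sup>2\<close>. They always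
  coincide, and the norm of the type is required to be this common norm; completeness is then
  the completeness of the type, and \<open>norm_lip\<close>, \<open>norm_rip\<close> contain the definiteness of the inner
  products. The coefficient algebras \<open>P\<close> and \<open>Q\<close> are C*-subalgebras of the types \<open>'p\<close> and \<open>'q\<close>;
  nothing is said about coefficients outside \<open>P\<close> and \<open>Q\<close>.\<close>

locale equivalence_bimodule =
  P: unital_cstar_subalgebra P + Q: unital_cstar_subalgebra Q
  for P :: "'p::unital_cstar_algebra set" and Q :: "'q::unital_cstar_algebra set" +
  fixes Y :: "('p, 'q, 'y::complex_banach) bimod"
  assumes lact_add_left: "p \<in> P \<Longrightarrow> p' \<in> P \<Longrightarrow> lact Y (p + p') y = lact Y p y + lact Y p' y"
    and lact_scaleC_left: "p \<in> P \<Longrightarrow> lact Y (s *\<^sub>C p) y = s *\<^sub>C lact Y p y"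
    and lact_linear: "p \<in> P \<Longrightarrow> clinear (lact Y p)"
    and lact_mult: "p \<in> P \<Longrightarrow> p' \<in> P \<Longrightarrow> lact Y (p * p') y = lact Y p (lact Y p' y)"
    and lact_one: "lact Y 1 y = y"
    and ract_add_right: "q \<in> Q \<Longrightarrow> q' \<in> Q \<Longrightarrow> ract Y y (q + q') = ract Y y q + ract Y y q'"
    and ract_scaleC_right: "q \<in> Q \<Longrightarrow> ract Y y (s *\<^sub>C q) = s *\<^sub>C ract Y y q"
    and ract_linear: "q \<in> Q \<Longrightarrow> clinear (\<lambda>y. ract Y y q)"
    and ract_mult: "q \<in> Q \<Longrightarrow> q' \<in> Q \<Longrightarrow> ract Y y (q * q') = ract Y (ract Y y q) q'"
    and ract_one: "ract Y y 1 = y"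
    and lact_ract: "p \<in> P \<Longrightarrow> q \<in> Q \<Longrightarrow> ract Y (lact Y p y) q = lact Y p (ract Y y q)"
    and lip_mem: "lip Y x y \<in> P"
    and lip_linear: "clinear (\<lambda>x. lip Y x y)"
    and lip_star: "star (lip Y x y) = lip Y y x"
    and lip_lact: "p \<in> P \<Longrightarrow> lip Y (lact Y p x) y = p * lip Y x y"
    and lip_pos: "positive_in P (lip Y x x)"
    and norm_lip: "norm (lip Y x x) = (norm x)\<^sup>2"
    and lip_full: "closure (cspan {lip Y x y | x y. True}) = P"
    and rip_mem: "rip Y x y \<in> Q"
    and rip_linear: "clinear (rip Y x)"
    and rip_star: "star (rip Y x y) = rip Y y x"
    and rip_ract: "q \<in> Q \<Longrightarrow> rip Y x (ract Y y q) = rip Y x y * q"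
    and rip_pos: "positive_in Q (rip Y x x)"
    and norm_rip: "norm (rip Y x x) = (norm x)\<^sup>2"
    and rip_full: "closure (cspan {rip Y x y | x y. True}) = Q"
    and rip_lact: "p \<in> P \<Longrightarrow> rip Y (lact Y p x) y = rip Y x (lact Y (star p) y)"
    and lip_ract: "q \<in> Q \<Longrightarrow> lip Y (ract Y x q) y = lip Y x (ract Y y (star q))"
    and imprimitivity: "lact Y (lip Y x y) z = ract Y x (rip Y y z)"

text \<open>The ambient algebras \<open>C\<close>, \<open>D\<close> and the bimodule \<open>Y\<close> are entire types.\<close>

locale strongly_morita_equivalent =
  A: unital_cstar_subalgebra A + B: unital_cstar_subalgebra B + equivalence_bimodule UNIV UNIV Y
  for A :: "'c::unital_cstar_algebra set" and B :: "'d::unital_cstar_algebra set"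
    and X :: "'y::complex_banach set" and Y :: "('c, 'd, 'y) bimod" +
  assumes closed_X: "closed X"
    and subspace_X: "csubspace X"
    and lact_X: "a \<in> A \<Longrightarrow> x \<in> X \<Longrightarrow> lact Y a x \<in> X"
    and lip_X: "x \<in> X \<Longrightarrow> y \<in> X \<Longrightarrow> lip Y x y \<in> A"
    and lip_XX: "closure (cspan {lip Y x y | x y. x \<in> X \<and> y \<in> X}) = A"
    and lip_YX: "closure (cspan {lip Y y x | y x. x \<in> X}) = UNIV"
    and ract_X: "b \<in> B \<Longrightarrow> x \<in> X \<Longrightarrow> ract Y x b \<in> X"
    and rip_X: "x \<in> X \<Longrightarrow> y \<in> X \<Longrightarrow> rip Y x y \<in> B"
    and rip_XX: "closure (cspan {rip Y x y | x y. x \<in> X \<and> y \<in> X}) = B"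
    and rip_YX: "closure (cspan {rip Y y x | y x. x \<in> X}) = UNIV"


section \<open>Conditional expectations and quasi-bases\<close>

locale conditional_expectation = unital_cstar_subalgebra A
  for A :: "'c::unital_cstar_algebra set" +
  fixes E :: "'c \<Rightarrow> 'c"
  assumes linear: "clinear E"
    and mem: "E c \<in> A"
    and id: "a \<in> A \<Longrightarrow> E a = a"
    and bimodule_map: "a \<in> A \<Longrightarrow> b \<in> A \<Longrightarrow> E (a * c * b) = a * E c * b"
    and positive: "positive_in A (E (star c * c))"

definition quasi_basis :: "('c::unital_cstar_algebra \<Rightarrow> 'c) \<Rightarrow> nat \<Rightarrow> (nat \<Rightarrow> 'c) \<Rightarrow> bool"
  where "quasi_basis E n u \<longleftrightarrow>
    (\<forall>c. (\<Sum>i<n. u i * E (star (u i) * c)) = c \<and> (\<Sum>i<n. E (c * u i) * star (u i)) = c)"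

definition index_finite :: "('c::unital_cstar_algebra \<Rightarrow> 'c) \<Rightarrow> bool"
  where "index_finite E \<longleftrightarrow> (\<exists>n u. quasi_basis E n u)"

locale bimodule_conditional_expectation =
  fixes A :: "'c::unital_cstar_algebra set" and B :: "'d::unital_cstar_algebra set"
    and X :: "'y::complex_banach set" and Y :: "('c, 'd, 'y) bimod"
    and E\<^sub>A :: "'c \<Rightarrow> 'c" and E\<^sub>B :: "'d \<Rightarrow> 'd" and E\<^sub>X :: "'y \<Rightarrow> 'y"
  assumes linear: "clinear E\<^sub>X"
    and onto: "range E\<^sub>X = X"
    and exp_lact: "x \<in> X \<Longrightarrow> E\<^sub>X (lact Y c x) = lact Y (E\<^sub>A c) x"
    and exp_lact_A: "a \<in> A \<Longrightarrow> E\<^sub>X (lact Y a y) = lact Y a (E\<^sub>X y)"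
    and exp_lip: "x \<in> X \<Longrightarrow> E\<^sub>A (lip Y y x) = lip Y (E\<^sub>X y) x"
    and exp_ract: "x \<in> X \<Longrightarrow> E\<^sub>X (ract Y x d) = ract Y x (E\<^sub>B d)"
    and exp_ract_B: "b \<in> B \<Longrightarrow> E\<^sub>X (ract Y y b) = ract Y (E\<^sub>X y) b"
    and exp_rip: "x \<in> X \<Longrightarrow> E\<^sub>B (rip Y y x) = rip Y (E\<^sub>X y) x"


section \<open>The basic construction\<close>

text \<open>The type \<open>'e\<close> is (a copy of) the C*-basic construction \<open>C\<^sub>1\<close> for \<open>E\<close>, with inclusion
  \<open>\<iota>\<close>, Jones projection \<open>e\<close> and action \<open>act\<close> on \<open>C\<close>, if the conditions below hold. They
  determine it up to isomorphism: since \<open>act\<close> is a function on \<open>C\<^sub>1\<close>, \<open>\<iota> a * e = 0\<close> with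
  \<open>a\<close> in the range of \<open>E\<close> implies \<open>a = a * E 1 = act (\<iota> a * e) 1 = 0\<close>, which is the
  condition singling out \<open>C\<^sub>1\<close> among the C*-algebras spanned by \<open>C e C\<close>.\<close>

locale basic_construction = unital_cstar_embedding \<iota>
  for \<iota> :: "'c::unital_cstar_algebra \<Rightarrow> 'e::unital_cstar_algebra" +
  fixes E :: "'c \<Rightarrow> 'c" and e :: 'e and act :: "'e \<Rightarrow> 'c \<Rightarrow> 'c"
  assumes jones_star: "star e = e"
    and jones_idem: "e * e = e"
    and jones: "e * \<iota> c * e = \<iota> (E c) * e"
    and span: "cspan {\<iota> x * e * \<iota> y | x y. True} = UNIV"
    and act_linear: "clinear (\<lambda>T. act T z)"
    and act_generator: "act (\<iota> x * e * \<iota> y) z = x * E (y * z)"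

definition basic_bimodule ::
  "('c::unital_cstar_algebra \<Rightarrow> 'e::unital_cstar_algebra) \<Rightarrow> ('c \<Rightarrow> 'c) \<Rightarrow> 'e \<Rightarrow> ('e \<Rightarrow> 'c \<Rightarrow> 'c)
    \<Rightarrow> ('e, 'c, 'c) bimod"
  where "basic_bimodule \<iota> E e act =
    \<lparr> lact = act, ract = (\<lambda>x a. x * a),
      lip = (\<lambda>x y. \<iota> x * e * \<iota> (star y)), rip = (\<lambda>x y. E (star x * y)) \<rparr>"


section \<open>Dual bimodules and tensor products\<close>

text \<open>\<open>'m dual\<close> is the conjugate vector space of \<open>'m\<close>, with \<open>Dual m\<close> in the role of
  \<open>m\<close> with a tilde.\<close>

datatype 'm dual = Dual (undual: 'm)

instantiation dual :: (complex_vector) complex_vector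
begin

definition "0 = Dual 0"
definition "a + b = Dual (undual a + undual b)"
definition "a - b = Dual (undual a - undual b)"
definition "- a = Dual (- undual a)"
definition "s *\<^sub>C a = Dual (cnj s *\<^sub>C undual a)"

instance
  by standard
    (simp_all add: zero_dual_def plus_dual_def minus_dual_def uminus_dual_def scaleC_dual_def
      add.assoc add.commute scaleC_add_right scaleC_add_left scaleC_scaleC scaleC_one)

end

definition dual_bimodule ::
  "('p::unital_cstar_algebra, 'q::unital_cstar_algebra, 'm) bimod \<Rightarrow> ('q, 'p, 'm dual) bimod"
  where "dual_bimodule M =
    \<lparr> lact = (\<lambda>q m. Dual (ract M (undual m) (star q))),
      ract = (\<lambda>m p. Dual (lact M (star p) (undual m))),
      lip = (\<lambda>m m'. rip M (undual m) (undual m')),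
      rip = (\<lambda>m m'. lip M (undual m) (undual m')) \<rparr>"

text \<open>The internal tensor product \<open>S \<otimes>\<^sub>Q T\<close> of a \<open>P\<close>-\<open>Q\<close>-equivalence bimodule with carrier \<open>S\<close>
  and a \<open>Q\<close>-\<open>R\<close>-equivalence bimodule with carrier \<open>T\<close>: the \<open>P\<close>-\<open>R\<close>-equivalence bimodule obtained
  from the algebraic tensor product over \<open>Q\<close> by completing for the inner products below. It is
  described up to isomorphism, as an equivalence bimodule \<open>Z\<close> with a map \<open>t\<close>, where \<open>t m n\<close> is
  the elementary tensor of \<open>m \<in> S\<close> and \<open>n \<in> T\<close>; the inner products of elementary tensors and
  the density of their span determine \<open>Z\<close> and \<open>t\<close>.\<close>

locale bimodule_tensor = equivalence_bimodule P R Z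
  for P :: "'p::unital_cstar_algebra set" and R :: "'r::unital_cstar_algebra set"
    and Z :: "('p, 'r, 'z::complex_banach) bimod" +
  fixes Q :: "'q::unital_cstar_algebra set"
    and S :: "'m::complex_vector set" and M :: "('p, 'q, 'm) bimod"
    and T :: "'n::complex_vector set" and N :: "('q, 'r, 'n) bimod"
    and t :: "'m \<Rightarrow> 'n \<Rightarrow> 'z"
  assumes tensor_add_left:
      "m \<in> S \<Longrightarrow> m' \<in> S \<Longrightarrow> n \<in> T \<Longrightarrow> t (m + m') n = t m n + t m' n"
    and tensor_add_right:
      "m \<in> S \<Longrightarrow> n \<in> T \<Longrightarrow> n' \<in> T \<Longrightarrow> t m (n + n') = t m n + t m n'"
    and tensor_scaleC_left: "m \<in> S \<Longrightarrow> n \<in> T \<Longrightarrow> t (s *\<^sub>C m) n = s *\<^sub>C t m n"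
    and tensor_scaleC_right: "m \<in> S \<Longrightarrow> n \<in> T \<Longrightarrow> t m (s *\<^sub>C n) = s *\<^sub>C t m n"
    and tensor_balanced:
      "m \<in> S \<Longrightarrow> n \<in> T \<Longrightarrow> q \<in> Q \<Longrightarrow> t (ract M m q) n = t m (lact N q n)"
    and lact_tensor: "m \<in> S \<Longrightarrow> n \<in> T \<Longrightarrow> p \<in> P \<Longrightarrow> lact Z p (t m n) = t (lact M p m) n"
    and ract_tensor: "m \<in> S \<Longrightarrow> n \<in> T \<Longrightarrow> r \<in> R \<Longrightarrow> ract Z (t m n) r = t m (ract N n r)"
    and lip_tensor: "m \<in> S \<Longrightarrow> n \<in> T \<Longrightarrow> m' \<in> S \<Longrightarrow> n' \<in> T \<Longrightarrow>
      lip Z (t m n) (t m' n') = lip M (ract M m (lip N n n')) m'"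
    and rip_tensor: "m \<in> S \<Longrightarrow> n \<in> T \<Longrightarrow> m' \<in> S \<Longrightarrow> n' \<in> T \<Longrightarrow>
      rip Z (t m n) (t m' n') = rip N n (lact N (rip M m m') n')"
    and tensor_dense: "closure (cspan {t m n | m n. m \<in> S \<and> n \<in> T}) = UNIV"

text \<open>The map \<open>\<phi>\<close> from \<open>Y\<close> to \<open>Y\<^sub>1\<close>, where \<open>s\<close> is the elementary tensor map of
  \<open>C \<otimes>\<^sub>A X\<close> and \<open>t\<close> that of \<open>(C \<otimes>\<^sub>A X) \<otimes>\<^sub>B D\<close>-tilde.\<close>

definition morita_embedding ::
  "('c::unital_cstar_algebra, 'd::unital_cstar_algebra, 'y::complex_banach) bimod \<Rightarrow> ('y \<Rightarrow> 'y)
    \<Rightarrow> nat \<Rightarrow> (nat \<Rightarrow> 'c) \<Rightarrow> nat \<Rightarrow> (nat \<Rightarrow> 'd)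
    \<Rightarrow> ('c \<Rightarrow> 'y \<Rightarrow> 'z::complex_banach) \<Rightarrow> ('z \<Rightarrow> 'd dual \<Rightarrow> 'w::complex_banach) \<Rightarrow> 'y \<Rightarrow> 'w"
  where "morita_embedding Y E\<^sub>X n u m v s t y =
    (\<Sum>i<n. \<Sum>j<m. t (s (u i) (E\<^sub>X (ract Y (lact Y (star (u i)) y) (v j)))) (Dual (v j)))"

end

theory Submission
  imports Defs
begin

text \<open>
The statement rests on two inner product formulas for the map \<open>\<phi>\<close>,
\<open>\<langle>\<phi> y, \<phi> z\<rangle> = \<iota>\<^sub>C \<langle>y, z\<rangle>\<close> on the left and \<open>\<langle>\<phi> y, \<phi> z\<rangle> = \<iota>\<^sub>D \<langle>y, z\<rangle>\<close> on the right
(\<open>lip_embedding\<close> and \<open>rip_embedding\<close>). Everything else is a general fact about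
equivalence bimodules (\<open>strongly_morita_equivalent_range\<close>): a map that carries both inner
products of \<open>Y\<close> to those of another equivalence bimodule, along embeddings of the coefficient
algebras, is automatically linear, isometric and compatible with the actions, and its range makes
the embeddings strongly Morita equivalent. The fullness conditions that mix the range with the
large bimodule need no computation with tensors: the closed span of the inner products is a left
ideal, and it contains \<open>1\<close> because \<open>Y\<close> itself is full.

For the formulas, let \<open>x \<in> X\<close>. On elementary tensors,
\<open>\<langle>\<phi> y, c \<otimes> x \<otimes> d\<^sup>~\<rangle> = \<iota>\<^sub>C \<langle>y, x \<cdot> d\<^sup>*\<rangle> e\<^sub>A \<iota>\<^sub>C c\<^sup>*\<close>. In the definition of \<open>\<phi> y\<close> the sum over
\<open>j\<close> collapses, since \<open>\<Sum>\<^sub>j E\<^sub>X(y \<cdot> v\<^sub>j) \<cdot> E\<^sub>B(v\<^sub>j\<^sup>* d) = E\<^sub>X(y \<cdot> d)\<close>, and the sum over \<open>i\<close> then collapses by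
the quasi-basis identity, since \<open>E\<^sub>X\<close> inside an inner product with \<open>X\<close> is \<open>E\<^sub>A\<close> outside.
Inserting \<open>\<phi> z\<close> in the second place uses two more facts: the reconstruction
\<open>z = \<Sum>\<^sub>j E\<^sub>X(z \<cdot> v\<^sub>j) \<cdot> v\<^sub>j\<^sup>*\<close> in \<open>Y\<close> (\<open>ract_reconstruction\<close>), and
\<open>\<Sum>\<^sub>i u\<^sub>i e\<^sub>A u\<^sub>i\<^sup>* = 1\<close> in \<open>C\<^sub>1\<close> (\<open>quasi_basis_unit\<close>). The formula on the right is obtained in the same
way with the roles of the two sides exchanged.
\<close>

section \<open>Complex-linear maps and the adjoint\<close>

lemmas clinear_add = module_hom.add[OF module_hom_linearI, of scaleC scaleC]
  and clinear_diff = module_hom.diff[OF module_hom_linearI, of scaleC scaleC]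
  and clinear_scaleC = module_hom.scale[OF module_hom_linearI, of scaleC scaleC]
  and clinear_zero = module_hom.zero[OF module_hom_linearI, of scaleC scaleC]
  and clinear_sum = module_hom.sum[OF module_hom_linearI, of scaleC scaleC]

lemma clinear_cspan_image: "clinear f \<Longrightarrow> cspan (f ` S) = f ` cspan S"
  unfolding cspan_def by (rule module_hom.span_image[OF module_hom_linearI])

lemma clinear_range_subspace: "clinear f \<Longrightarrow> csubspace (range f)"
  by (metis clinear_cspan_image complex_vector.span_UNIV complex_vector.subspace_span)

lemma clinearI:
  fixes f :: "'a::complex_vector \<Rightarrow> 'b::complex_vector"
  assumes "\<And>x y. f (x + y) = f x + f y" and "\<And>c x. f (c *\<^sub>C x) = c *\<^sub>C f x"
  shows "clinear f"
  using assms by unfold_locales auto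

lemma clinear_bounded:
  fixes f :: "'a::complex_banach \<Rightarrow> 'b::complex_banach"
  assumes "clinear f" and "\<And>x. norm (f x) \<le> norm x * K"
  shows "bounded_linear f"
  using assms(2) by (intro bounded_linear_intro[where K=K])
    (auto simp: scaleR_scaleC clinear_add[OF assms(1)] clinear_scaleC[OF assms(1)])

lemma closed_clinear_isometry_image:
  fixes f :: "'a::complex_banach \<Rightarrow> 'b::complex_banach"
  assumes "clinear f" and "\<And>x. norm (f x) = norm x" and "closed S"
  shows "closed (f ` S)"
proof -
  have complete_image: "complete (f ` S)"
    unfolding complete_def
  proof (intro allI impI)
    fix g :: "nat \<Rightarrow> 'b"
    assume g: "(\<forall>n. g n \<in> f ` S) \<and> Cauchy g"
    then have "\<forall>n. \<exists>x. x \<in> S \<and> g n = f x"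
      by blast
    then obtain h where h: "\<And>n. h n \<in> S" "\<And>n. g n = f (h n)"
      by metis
    have "dist (f x) (f y) = dist x y" for x y
      using assms(2) by (simp add: dist_norm flip: clinear_diff[OF assms(1)])
    with g h(2) have "Cauchy h"
      by (simp add: Cauchy_def)
    then obtain l where l: "h \<longlonglongrightarrow> l"
      using Cauchy_convergent_iff convergent_def by blast
    then have "l \<in> S"
      using h(1) \<open>closed S\<close> closed_sequentially by blast
    moreover have "bounded_linear f"
      using assms(1,2) by (intro clinear_bounded[where K=1]) auto
    then have "(\<lambda>n. f (h n)) \<longlonglongrightarrow> f l"
      using l by (rule bounded_linear.tendsto)
    ultimately show "\<exists>l\<in>f ` S. g \<longlonglongrightarrow> l"
      unfolding h(2)[abs_def] by blast
  qed
  then show ?thesis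
    by (rule complete_imp_closed)
qed

lemma closure_cspan_isometry_image:
  fixes f :: "'a::complex_banach \<Rightarrow> 'b::complex_banach"
  assumes "clinear f" and iso: "\<And>x. norm (f x) = norm x"
  shows "closure (cspan (f ` S)) = f ` closure (cspan S)"
proof
  have span: "cspan (f ` S) = f ` cspan S"
    by (rule clinear_cspan_image[OF assms(1)])
  have "bounded_linear f"
    using assms by (intro clinear_bounded[where K=1]) auto
  then show "f ` closure (cspan S) \<subseteq> closure (cspan (f ` S))"
    unfolding span by (intro image_closure_subset closure_subset)
      (auto simp: linear_continuous_on)
  show "closure (cspan (f ` S)) \<subseteq> f ` closure (cspan S)"
    unfolding span using assms
    by (intro closure_minimal image_mono closure_subset closed_clinear_isometry_image) auto
qed

text \<open>Fullness of an inner product is used in this form: it puts \<open>1\<close> into the closed span of the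
  inner products, and the value at \<open>p = 1\<close> of \<open>p \<mapsto> p \<cdot> w\<close> is \<open>w\<close> itself.\<close>

lemma clinear_vanishes_at_one:
  fixes f :: "'a::unital_cstar_algebra \<Rightarrow> 'b::complex_banach"
  assumes "clinear f" and "\<And>x. norm (f x) \<le> norm x * K"
    and zero: "\<And>x. x \<in> S \<Longrightarrow> f x = 0" and one: "1 \<in> closure (cspan S)"
  shows "f 1 = 0"
proof -
  have "cspan S \<subseteq> {x. f x = 0}"
    using zero
    by (intro complex_vector.span_minimal)
      (auto simp: complex_vector.subspace_def clinear_add[OF assms(1)] clinear_scaleC[OF assms(1)]
        clinear_zero[OF assms(1)])
  moreover have "closed {x. f x = 0}"
    using clinear_bounded[OF assms(1,2)]
    by (intro closed_Collect_eq) (auto simp: linear_continuous_on continuous_on_const)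
  ultimately show ?thesis
    using one closure_minimal by blast
qed

lemma closure_cspan_left_ideal:
  fixes S :: "'a::unital_cstar_algebra set"
  assumes ideal: "\<And>p x. x \<in> S \<Longrightarrow> p * x \<in> S" and one: "1 \<in> closure (cspan S)"
  shows "closure (cspan S) = UNIV"
proof (intro equalityI subset_UNIV subsetI)
  fix p :: 'a
  have "clinear ((*) p)"
    by (rule clinearI) (auto simp: distrib_left mult_scaleC_right)
  then have "(*) p ` cspan S = cspan ((*) p ` S)"
    by (rule clinear_cspan_image[symmetric])
  also have "\<dots> \<subseteq> cspan S"
    using ideal by (intro complex_vector.span_mono) auto
  finally have "(*) p ` closure (cspan S) \<subseteq> closure (cspan S)"
    by (intro image_closure_subset) (auto intro: continuous_intros closure_subset[THEN subsetD])
  from this[THEN subsetD, OF imageI, OF one] show "p \<in> closure (cspan S)"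
    by simp
qed

lemma star_zero: "star 0 = (0::'a::unital_cstar_algebra)"
  using star_add[of "0::'a" 0] by simp

lemma star_minus: "star (- x) = - star (x::'a::unital_cstar_algebra)"
  using star_add[of x "- x"] by (simp add: star_zero minus_unique)

lemma star_diff: "star (x - y) = star x - star (y::'a::unital_cstar_algebra)"
  using star_add[of x "- y"] by (simp add: star_minus)

lemma star_one: "star 1 = (1::'a::unital_cstar_algebra)"
  by (metis mult_1_left star_mult star_star mult_1_right)

lemma norm_star: "norm (star x) = norm (x::'a::unital_cstar_algebra)"
proof -
  have le: "norm z \<le> norm (star z)" for z :: 'a
  proof (cases "z = 0")
    case False
    have "norm z * norm z \<le> norm (star z) * norm z"
      using norm_mult_ineq[of "star z" z] by (simp add: cstar_identity power2_eq_square)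
    with False show ?thesis
      by simp
  qed simp
  show ?thesis
    using le[of x] le[of "star x"] by (simp add: star_star)
qed

lemma star_sum: "star (sum f S) = (\<Sum>i\<in>S. star (f i :: 'a::unital_cstar_algebra))"
  by (induction S rule: infinite_finite_induct) (auto simp: star_zero star_add)

context unital_cstar_embedding
begin

lemma range_subalgebra: "unital_cstar_subalgebra (range \<iota>)"
proof
  show "closed (range \<iota>)"
    using closed_clinear_isometry_image[OF linear isometric closed_UNIV] .
  show "csubspace (range \<iota>)"
    by (rule clinear_range_subspace[OF linear])
  show "1 \<in> range \<iota>"
    by (metis one rangeI)
qed (auto simp flip: mult star)

end


section \<open>Equivalence bimodules\<close>

context equivalence_bimodule
begin

lemmas lip_add_left = clinear_add[OF lip_linear]
  and lip_diff_left = clinear_diff[OF lip_linear]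
  and lip_scaleC_left = clinear_scaleC[OF lip_linear]
  and lip_sum_left = clinear_sum[OF lip_linear]
  and rip_diff_right = clinear_diff[OF rip_linear]
  and rip_sum_right = clinear_sum[OF rip_linear]

lemma lip_add_right: "lip Y x (y + z) = lip Y x y + lip Y x z"
  by (metis lip_star lip_add_left star_add)

lemma lip_diff_right: "lip Y x (y - z) = lip Y x y - lip Y x z"
  by (metis lip_star lip_diff_left star_diff)

lemma lip_scaleC_right: "lip Y x (c *\<^sub>C y) = cnj c *\<^sub>C lip Y x y"
  by (metis lip_star lip_scaleC_left star_scaleC)

lemma lip_sum_right: "lip Y x (sum f S) = (\<Sum>i\<in>S. lip Y x (f i))"
  by (subst lip_star[symmetric]) (simp add: lip_sum_left star_sum lip_star)

lemma rip_diff_left: "rip Y (x - y) z = rip Y x z - rip Y y z"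
  by (metis rip_star rip_diff_right star_diff)

lemma rip_sum_left: "rip Y (sum f S) x = (\<Sum>i\<in>S. rip Y (f i) x)"
  by (subst rip_star[symmetric]) (simp add: rip_sum_right star_sum rip_star)

lemma lip_lact_right: "p \<in> P \<Longrightarrow> lip Y x (lact Y p y) = lip Y x y * star p"
  by (metis lip_star lip_lact star_mult)

lemma rip_ract_left: "q \<in> Q \<Longrightarrow> rip Y (ract Y x q) y = star q * rip Y x y"
  by (metis rip_star rip_ract star_mult)

lemma lip_eq_0_iff: "lip Y x x = 0 \<longleftrightarrow> x = 0"
  by (metis norm_lip norm_eq_zero zero_eq_power2)

lemma lact_clinear_left: "P = UNIV \<Longrightarrow> clinear (\<lambda>p. lact Y p y)"
  by (rule clinearI) (auto simp: lact_add_left lact_scaleC_left)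

lemma ract_clinear_right: "Q = UNIV \<Longrightarrow> clinear (ract Y y)"
  by (rule clinearI) (auto simp: ract_add_right ract_scaleC_right)

lemma norm_lact_le:
  assumes "p \<in> P"
  shows "norm (lact Y p y) \<le> norm p * norm y"
proof (rule power2_le_imp_le)
  have "(norm (lact Y p y))\<^sup>2 = norm (p * (lip Y y y * star p))"
    using assms by (simp add: lip_lact lip_lact_right mult.assoc flip: norm_lip)
  also have "\<dots> \<le> norm p * (norm (lip Y y y) * norm (star p))"
    by (meson norm_mult_ineq mult_left_mono norm_ge_zero order_trans)
  finally show "(norm (lact Y p y))\<^sup>2 \<le> (norm p * norm y)\<^sup>2"
    by (simp add: norm_lip norm_star power2_eq_square ac_simps)
qed simp

lemma norm_ract_le:
  assumes "q \<in> Q"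
  shows "norm (ract Y y q) \<le> norm q * norm y"
proof (rule power2_le_imp_le)
  have "(norm (ract Y y q))\<^sup>2 = norm (star q * (rip Y y y * q))"
    using assms by (simp add: rip_ract rip_ract_left mult.assoc flip: norm_rip)
  also have "\<dots> \<le> norm (star q) * (norm (rip Y y y) * norm q)"
    by (meson norm_mult_ineq mult_left_mono norm_ge_zero order_trans)
  finally show "(norm (ract Y y q))\<^sup>2 \<le> (norm q * norm y)\<^sup>2"
    by (simp add: norm_rip norm_star power2_eq_square ac_simps)
qed simp

end

context strongly_morita_equivalent
begin

text \<open>By imprimitivity such a vector is annihilated by \<open>\<langle>X, X\<rangle>\<close> (on the other side), which is dense
  in an algebra containing \<open>1\<close>.\<close>

lemma eq_0_if_lip_X_eq_0:
  assumes "\<And>x. x \<in> X \<Longrightarrow> lip Y w x = 0"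
  shows "w = 0"
proof -
  have "ract Y w 1 = 0"
  proof (rule clinear_vanishes_at_one[OF ract_clinear_right])
    show "norm (ract Y w q) \<le> norm q * norm w" for q
      by (rule norm_ract_le) simp
    show "1 \<in> closure (cspan {rip Y x y | x y. x \<in> X \<and> y \<in> X})"
      by (simp add: rip_XX B.one_mem)
    show "ract Y w q = 0" if "q \<in> {rip Y x y | x y. x \<in> X \<and> y \<in> X}" for q
      using that assms clinear_zero[OF lact_clinear_left]
      by (auto simp flip: imprimitivity)
  qed simp
  then show ?thesis
    by (simp add: ract_one)
qed

lemma eq_0_if_rip_X_eq_0:
  assumes "\<And>x. x \<in> X \<Longrightarrow> rip Y w x = 0"
  shows "w = 0"
proof -
  have "lact Y 1 w = 0"
  proof (rule clinear_vanishes_at_one[OF lact_clinear_left])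
    show "norm (lact Y p w) \<le> norm p * norm w" for p
      by (rule norm_lact_le) simp
    show "1 \<in> closure (cspan {lip Y x y | x y. x \<in> X \<and> y \<in> X})"
      by (simp add: lip_XX A.one_mem)
    show "lact Y p w = 0" if "p \<in> {lip Y x y | x y. x \<in> X \<and> y \<in> X}" for p
    proof -
      from that obtain x y where "x \<in> X" "y \<in> X" "p = lip Y x y"
        by auto
      moreover from this have "rip Y y w = 0"
        by (metis assms rip_star star_zero)
      ultimately show ?thesis
        by (simp add: imprimitivity clinear_zero[OF ract_clinear_right])
    qed
  qed simp
  then show ?thesis
    by (simp add: lact_one)
qed

end

text \<open>A map that preserves both inner products is automatically linear and compatible with the
  actions: the defect \<open>w\<close> of any of these identities satisfies \<open>\<langle>w, f z\<rangle> = 0\<close> for all \<open>z\<close>, and it is a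
  combination of vectors \<open>f z\<close> with coefficients, hence \<open>\<langle>w, w\<rangle> = 0\<close>. It is also isometric, so that
  its range is closed. The density of the span of \<open>\<langle>Z, f Y\<rangle>\<close> comes for free: its closure is a left
  ideal, and it contains \<open>1\<close> because it contains the closed span of \<open>\<langle>f Y, f Y\<rangle>\<close>, which is the range
  of a unital embedding.\<close>

theorem strongly_morita_equivalent_range:
  fixes Y :: "('c::unital_cstar_algebra, 'd::unital_cstar_algebra, 'y::complex_banach) bimod"
    and Z :: "('e::unital_cstar_algebra, 'f::unital_cstar_algebra, 'z::complex_banach) bimod"
  assumes "equivalence_bimodule UNIV UNIV Y" and "equivalence_bimodule UNIV UNIV Z"
    and "unital_cstar_embedding \<iota>" and "unital_cstar_embedding \<kappa>"
    and lip_f: "\<And>x y. lip Z (f x) (f y) = \<iota> (lip Y x y)"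
    and rip_f: "\<And>x y. rip Z (f x) (f y) = \<kappa> (rip Y x y)"
  shows "strongly_morita_equivalent (range \<iota>) (range \<kappa>) (range f) Z"
proof -
  interpret Y: equivalence_bimodule UNIV UNIV Y by fact
  interpret Z: equivalence_bimodule UNIV UNIV Z by fact
  interpret \<iota>: unital_cstar_embedding \<iota> by fact
  interpret \<kappa>: unital_cstar_embedding \<kappa> by fact
  note \<iota>_simps = clinear_add[OF \<iota>.linear] clinear_diff[OF \<iota>.linear] clinear_scaleC[OF \<iota>.linear]
    clinear_zero[OF \<iota>.linear] \<iota>.mult \<iota>.star
  have f_add: "f (x + y) = f x + f y" for x y
  proof -
    define w where "w = f (x + y) - (f x + f y)"
    have "lip Z w (f z) = 0" for z
      by (simp add: w_def Z.lip_diff_left Z.lip_add_left lip_f Y.lip_add_left \<iota>_simps)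
    then have "lip Z w w = 0"
      by (subst (2) w_def) (simp add: Z.lip_diff_right Z.lip_add_right)
    then show ?thesis
      by (simp add: Z.lip_eq_0_iff w_def)
  qed
  have f_scaleC: "f (c *\<^sub>C x) = c *\<^sub>C f x" for c x
  proof -
    define w where "w = f (c *\<^sub>C x) - c *\<^sub>C f x"
    have "lip Z w (f z) = 0" for z
      by (simp add: w_def Z.lip_diff_left Z.lip_scaleC_left lip_f Y.lip_scaleC_left \<iota>_simps)
    then have "lip Z w w = 0"
      by (subst (2) w_def) (simp add: Z.lip_diff_right Z.lip_scaleC_right)
    then show ?thesis
      by (simp add: Z.lip_eq_0_iff w_def)
  qed
  have f_lact: "f (lact Y c x) = lact Z (\<iota> c) (f x)" for c x
  proof -
    define w where "w = f (lact Y c x) - lact Z (\<iota> c) (f x)"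
    have "lip Z w (f z) = 0" for z
      by (simp add: w_def Z.lip_diff_left Z.lip_lact lip_f Y.lip_lact \<iota>_simps)
    then have "lip Z w w = 0"
      by (subst (2) w_def) (simp add: Z.lip_diff_right Z.lip_lact_right)
    then show ?thesis
      by (simp add: Z.lip_eq_0_iff w_def)
  qed
  have f_ract: "f (ract Y x d) = ract Z (f x) (\<kappa> d)" for d x
  proof -
    define w where "w = f (ract Y x d) - ract Z (f x) (\<kappa> d)"
    have "rip Z (f z) w = 0" for z
      by (simp add: w_def Z.rip_diff_right Z.rip_ract rip_f Y.rip_ract \<kappa>.mult)
    then have "rip Z w w = 0"
      by (subst (1) w_def) (simp add: Z.rip_diff_left Z.rip_ract_left)
    then have "w = 0"
      by (metis Z.norm_rip norm_eq_zero zero_eq_power2)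
    then show ?thesis
      by (simp add: w_def)
  qed
  have linear: "clinear f"
    by (rule clinearI) (fact f_add f_scaleC)+
  have isometric: "norm (f x) = norm x" for x
    using Z.norm_lip[of "f x"] Y.norm_lip[of x]
    by (simp add: lip_f \<iota>.isometric power2_eq_iff_nonneg)
  have lip_span: "closure (cspan {lip Z x y | x y. x \<in> range f \<and> y \<in> range f}) = range \<iota>"
  proof -
    have "{lip Z x y | x y. x \<in> range f \<and> y \<in> range f} = {lip Z (f x) (f y) | x y. True}"
      by blast
    also have "\<dots> = \<iota> ` {lip Y x y | x y. True}"
      unfolding lip_f by blast
    finally show ?thesis
      by (simp only: closure_cspan_isometry_image[OF \<iota>.linear \<iota>.isometric] Y.lip_full)
  qed
  have rip_span: "closure (cspan {rip Z x y | x y. x \<in> range f \<and> y \<in> range f}) = range \<kappa>"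
  proof -
    have "{rip Z x y | x y. x \<in> range f \<and> y \<in> range f} = {rip Z (f x) (f y) | x y. True}"
      by blast
    also have "\<dots> = \<kappa> ` {rip Y x y | x y. True}"
      unfolding rip_f by blast
    finally show ?thesis
      by (simp only: closure_cspan_isometry_image[OF \<kappa>.linear \<kappa>.isometric] Y.rip_full)
  qed
  have lip_full: "closure (cspan {lip Z z x | z x. x \<in> range f}) = UNIV"
  proof (rule closure_cspan_left_ideal)
    show "p * r \<in> {lip Z z x | z x. x \<in> range f}" if "r \<in> {lip Z z x | z x. x \<in> range f}" for p r
    proof -
      from that obtain z x where "x \<in> range f" "r = lip Z z x"
        by blast
      moreover from this have "p * r = lip Z (lact Z p z) x"
        by (simp add: Z.lip_lact)
      ultimately show ?thesis
        by blast
    qed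
    have "1 \<in> range \<iota>"
      by (metis \<iota>.one rangeI)
    also have "range \<iota> \<subseteq> closure (cspan {lip Z z x | z x. x \<in> range f})"
      unfolding lip_span[symmetric]
      by (intro closure_mono complex_vector.span_mono) auto
    finally show "1 \<in> closure (cspan {lip Z z x | z x. x \<in> range f})" .
  qed
  have rip_full: "closure (cspan {rip Z z x | z x. x \<in> range f}) = UNIV"
  proof (rule closure_cspan_left_ideal)
    \<comment> \<open>The right inner product is conjugate-linear in its first variable: multiplication
      by \<open>q\<close> from the left is absorbed as the right action of \<open>star q\<close>.\<close>
    show "q * r \<in> {rip Z z x | z x. x \<in> range f}" if "r \<in> {rip Z z x | z x. x \<in> range f}" for q r
    proof -
      from that obtain z x where "x \<in> range f" "r = rip Z z x"
        by blast
      moreover from this have "q * r = rip Z (ract Z z (star q)) x"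
        by (simp add: Z.rip_ract_left star_star)
      ultimately show ?thesis
        by blast
    qed
    have "1 \<in> range \<kappa>"
      by (metis \<kappa>.one rangeI)
    also have "range \<kappa> \<subseteq> closure (cspan {rip Z z x | z x. x \<in> range f})"
      unfolding rip_span[symmetric]
      by (intro closure_mono complex_vector.span_mono) auto
    finally show "1 \<in> closure (cspan {rip Z z x | z x. x \<in> range f})" .
  qed
  have closed: "closed (range f)"
    using closed_clinear_isometry_image[OF linear isometric closed_UNIV] .
  have subspace: "csubspace (range f)"
    by (rule clinear_range_subspace[OF linear])
  interpret A: unital_cstar_subalgebra "range \<iota>" by (rule \<iota>.range_subalgebra)
  interpret B: unital_cstar_subalgebra "range \<kappa>" by (rule \<kappa>.range_subalgebra)
  show ?thesis
  proof unfold_locales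
    show "lact Z a x \<in> range f" if "a \<in> range \<iota>" "x \<in> range f" for a x
      using that by (auto simp flip: f_lact)
    show "ract Z x b \<in> range f" if "b \<in> range \<kappa>" "x \<in> range f" for b x
      using that by (auto simp flip: f_ract)
    show "lip Z x y \<in> range \<iota>" "rip Z x y \<in> range \<kappa>" if "x \<in> range f" "y \<in> range f" for x y
      using that by (auto simp: lip_f rip_f)
  qed (fact closed subspace lip_span rip_span lip_full rip_full)+
qed


section \<open>Conditional expectations and the basic construction\<close>

text \<open>Positivity makes \<open>E\<close> self-adjoint at all \<open>star c * c\<close>; these elements span, since
  \<open>h = ((h + 1)\<^sup>2 - h\<^sup>2 - 1) / 2\<close> for self-adjoint \<open>h\<close>.\<close>

lemma (in conditional_expectation) exp_star: "E (star c) = star (E c)"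
proof -
  note simps = clinear_add[OF linear] clinear_diff[OF linear] clinear_scaleC[OF linear]
  have pos: "star (E (star c * c)) = E (star c * c)" for c
    using positive[of c] by (auto simp: positive_in_def star_mult star_star)
  have sa: "star (E h) = E h" if h: "star h = h" for h
  proof -
    have "h + h = star (h + 1) * (h + 1) - star h * h - star 1 * 1"
      by (simp add: h star_add star_one algebra_simps)
    then have "star (E (h + h)) = E (h + h)"
      by (metis (no_types, lifting) pos clinear_diff[OF linear] star_diff)
    then have "star (E h) + star (E h) = E h + E h"
      by (simp add: simps star_add)
    then show ?thesis
      by (metis scaleR_2 scaleR_cancel_left zero_neq_numeral)
  qed
  define h k where "h = c + star c" and "k = \<i> *\<^sub>C (c - star c)"
  have "star h = h" "star k = k"
    by (simp_all add: h_def k_def star_add star_star star_scaleC star_diff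
        complex_vector.scale_right_diff_distrib add.commute)
  then have "star (E h) = E h" "star (E k) = E k"
    using sa by auto
  then have "star (E c) + star (E (star c)) = E c + E (star c)"
    and "\<i> *\<^sub>C (star (E (star c)) - star (E c)) = \<i> *\<^sub>C (E c - E (star c))"
    by (auto simp: h_def k_def simps star_add star_scaleC star_diff
        complex_vector.scale_right_diff_distrib)
  then have sum: "star (E c) + star (E (star c)) = E c + E (star c)"
    and diff: "star (E (star c)) - star (E c) = E c - E (star c)"
    by simp_all
  from arg_cong2[OF sum diff, of minus] have "star (E c) + star (E c) = E (star c) + E (star c)"
    by (simp add: algebra_simps)
  then show ?thesis
    by (metis scaleR_2 scaleR_cancel_left zero_neq_numeral)
qed

lemma quasi_basis_left: "quasi_basis E n u \<Longrightarrow> (\<Sum>i<n. u i * E (star (u i) * c)) = c"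
  and quasi_basis_right: "quasi_basis E n u \<Longrightarrow> (\<Sum>i<n. E (c * u i) * star (u i)) = c"
  by (auto simp: quasi_basis_def)

text \<open>The sum is a left unit for the generators \<open>\<iota> x * e * \<iota> y\<close>, by the quasi-basis identity.\<close>

lemma (in basic_construction) quasi_basis_unit:
  assumes qb: "quasi_basis E n u"
  shows "(\<Sum>i<n. \<iota> (u i) * e * \<iota> (star (u i))) = 1" (is "?p = 1")
proof -
  have gen: "?p * (\<iota> x * e * \<iota> y) = \<iota> x * e * \<iota> y" for x y
  proof -
    have "?p * (\<iota> x * e * \<iota> y) = (\<Sum>i<n. \<iota> (u i) * (e * \<iota> (star (u i) * x) * e)) * \<iota> y"
      unfolding sum_distrib_right mult by (simp only: mult.assoc)
    also have "\<dots> = \<iota> (\<Sum>i<n. u i * E (star (u i) * x)) * e * \<iota> y"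
      unfolding jones by (simp add: mult clinear_sum[OF linear] sum_distrib_right mult.assoc)
    finally show ?thesis
      by (simp add: quasi_basis_left[OF qb])
  qed
  have "cspan {\<iota> x * e * \<iota> y | x y. True} \<subseteq> {T. ?p * T = T}"
    by (intro complex_vector.span_minimal)
      (auto simp: gen complex_vector.subspace_def distrib_left mult_scaleC_right)
  then have "?p * 1 = 1"
    unfolding span by blast
  then show ?thesis
    by simp
qed


section \<open>Conditional expectations on bimodules\<close>

locale morita_conditional_expectation =
  strongly_morita_equivalent A B X Y +
  EA: conditional_expectation A E\<^sub>A + EB: conditional_expectation B E\<^sub>B +
  EX: bimodule_conditional_expectation A B X Y E\<^sub>A E\<^sub>B E\<^sub>X
  for A :: "'c::unital_cstar_algebra set" and B :: "'d::unital_cstar_algebra set"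
    and X :: "'y::complex_banach set" and Y :: "('c, 'd, 'y) bimod"
    and E\<^sub>A :: "'c \<Rightarrow> 'c" and E\<^sub>B :: "'d \<Rightarrow> 'd" and E\<^sub>X :: "'y \<Rightarrow> 'y"
begin

lemma EX_mem: "E\<^sub>X y \<in> X"
  using EX.onto by blast

lemma exp_rip_right: "x \<in> X \<Longrightarrow> rip Y x (E\<^sub>X y) = E\<^sub>B (rip Y x y)"
  by (metis EX.exp_rip EB.exp_star rip_star)

text \<open>The quasi-basis identities pass from the algebras to the bimodule because they can be tested
  against inner products with \<open>X\<close>, which turn \<open>E\<^sub>X\<close> into \<open>E\<^sub>A\<close> or \<open>E\<^sub>B\<close>.\<close>

lemma lact_reconstruction:
  assumes qb: "quasi_basis E\<^sub>A n u"
  shows "(\<Sum>i<n. lact Y (u i) (E\<^sub>X (lact Y (star (u i)) y))) = y" (is "?y = y")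
proof -
  have "lip Y (?y - y) x = 0" if "x \<in> X" for x
    using that by (simp add: lip_diff_left lip_sum_left lip_lact quasi_basis_left[OF qb]
        flip: EX.exp_lip)
  then show ?thesis
    using eq_0_if_lip_X_eq_0[of "?y - y"] by simp
qed

lemma ract_reconstruction:
  assumes qb: "quasi_basis E\<^sub>B m v"
  shows "(\<Sum>j<m. ract Y (E\<^sub>X (ract Y y (v j))) (star (v j))) = y" (is "?y = y")
proof -
  have "rip Y (?y - y) x = 0" if "x \<in> X" for x
    using that by (simp add: rip_diff_left rip_sum_left rip_ract_left star_star
        quasi_basis_left[OF qb] flip: EX.exp_rip)
  then show ?thesis
    using eq_0_if_rip_X_eq_0[of "?y - y"] by simp
qed

lemma sum_ract_EX:
  assumes qb: "quasi_basis E\<^sub>B m v"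
  shows "(\<Sum>j<m. ract Y (E\<^sub>X (ract Y y (v j))) (E\<^sub>B (star (v j) * d))) = E\<^sub>X (ract Y y d)"
proof -
  have "(\<Sum>j<m. ract Y (E\<^sub>X (ract Y y (v j))) (E\<^sub>B (star (v j) * d)))
      = E\<^sub>X (ract Y y (\<Sum>j<m. v j * E\<^sub>B (star (v j) * d)))"
    by (simp add: EB.mem ract_mult clinear_sum[OF ract_clinear_right]
        clinear_sum[OF EX.linear] flip: EX.exp_ract_B)
  then show ?thesis
    by (simp add: quasi_basis_left[OF qb])
qed

lemma sum_lact_EX:
  assumes qb: "quasi_basis E\<^sub>A n u"
  shows "(\<Sum>i<n. lact Y (E\<^sub>A (c * u i)) (E\<^sub>X (lact Y (star (u i)) y))) = E\<^sub>X (lact Y c y)"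
proof -
  have "(\<Sum>i<n. lact Y (E\<^sub>A (c * u i)) (E\<^sub>X (lact Y (star (u i)) y)))
      = E\<^sub>X (lact Y (\<Sum>i<n. E\<^sub>A (c * u i) * star (u i)) y)"
    by (simp add: EA.mem lact_mult clinear_sum[OF lact_clinear_left]
        clinear_sum[OF EX.linear] flip: EX.exp_lact_A)
  then show ?thesis
    by (simp add: quasi_basis_right[OF qb])
qed

end


section \<open>The embedding into the tensor product\<close>

locale morita_basic_construction =
  morita_conditional_expectation A B X Y E\<^sub>A E\<^sub>B E\<^sub>X +
  C1: basic_construction \<iota>\<^sub>C E\<^sub>A e\<^sub>A act\<^sub>C + D1: basic_construction \<iota>\<^sub>D E\<^sub>B e\<^sub>B act\<^sub>D +
  CX: bimodule_tensor UNIV B CX A UNIV "basic_bimodule \<iota>\<^sub>C E\<^sub>A e\<^sub>A act\<^sub>C" X Y s +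
  Y1: bimodule_tensor UNIV UNIV Y1 B UNIV CX
        UNIV "dual_bimodule (basic_bimodule \<iota>\<^sub>D E\<^sub>B e\<^sub>B act\<^sub>D)" t
  for A :: "'c::unital_cstar_algebra set" and B :: "'d::unital_cstar_algebra set"
    and X :: "'y::complex_banach set" and Y :: "('c, 'd, 'y) bimod"
    and E\<^sub>A :: "'c \<Rightarrow> 'c" and E\<^sub>B :: "'d \<Rightarrow> 'd" and E\<^sub>X :: "'y \<Rightarrow> 'y"
    and \<iota>\<^sub>C :: "'c \<Rightarrow> 'c1::unital_cstar_algebra" and e\<^sub>A :: 'c1 and act\<^sub>C :: "'c1 \<Rightarrow> 'c \<Rightarrow> 'c"
    and \<iota>\<^sub>D :: "'d \<Rightarrow> 'd1::unital_cstar_algebra" and e\<^sub>B :: 'd1 and act\<^sub>D :: "'d1 \<Rightarrow> 'd \<Rightarrow> 'd"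
    and CX :: "('c1, 'd, 'cx::complex_banach) bimod" and s :: "'c \<Rightarrow> 'y \<Rightarrow> 'cx"
    and Y1 :: "('c1, 'd1, 'y1::complex_banach) bimod" and t :: "'cx \<Rightarrow> 'd dual \<Rightarrow> 'y1" +
  fixes n m :: nat and u :: "nat \<Rightarrow> 'c" and v :: "nat \<Rightarrow> 'd"
  assumes u: "quasi_basis E\<^sub>A n u" and v: "quasi_basis E\<^sub>B m v"
begin

abbreviation \<phi> :: "'y \<Rightarrow> 'y1"
  where "\<phi> \<equiv> morita_embedding Y E\<^sub>X n u m v s t"

lemma lip_elementary:
  assumes "x \<in> X" and "x' \<in> X"
  shows "lip Y1 (t (s c x) (Dual d)) (t (s c' x') (Dual d'))
    = \<iota>\<^sub>C (c * lip Y (ract Y x (E\<^sub>B (star d * d'))) x') * e\<^sub>A * \<iota>\<^sub>C (star c')"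
  using assms
  by (simp add: Y1.lip_tensor CX.lip_tensor CX.ract_tensor EB.mem ract_X
      dual_bimodule_def basic_bimodule_def)

lemma rip_elementary:
  assumes "x \<in> X" and "x' \<in> X"
  shows "rip Y1 (t (s c x) (Dual d)) (t (s c' x') (Dual d'))
    = \<iota>\<^sub>D d * e\<^sub>B * \<iota>\<^sub>D (rip Y x (lact Y (E\<^sub>A (star c * c')) x') * star d')"
  using assms
  by (simp add: Y1.rip_tensor CX.rip_tensor star_mult star_star
      dual_bimodule_def basic_bimodule_def)

text \<open>These two formulas identify \<open>\<phi> y\<close> by its inner products with elementary tensors; the sum over
  one quasi-basis reassembles the argument of \<open>E\<^sub>X\<close>, the sum over the other one then removes the
  conditional expectation.\<close>

lemma lip_embedding_elementary:
  assumes x: "x \<in> X"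
  shows "lip Y1 (\<phi> y) (t (s c x) (Dual d)) = \<iota>\<^sub>C (lip Y y (ract Y x (star d))) * e\<^sub>A * \<iota>\<^sub>C (star c)"
proof -
  let ?x = "\<lambda>i j. E\<^sub>X (ract Y (lact Y (star (u i)) y) (v j))"
  have "lip Y1 (\<phi> y) (t (s c x) (Dual d))
      = (\<Sum>i<n. \<Sum>j<m. \<iota>\<^sub>C (u i * lip Y (ract Y (?x i j) (E\<^sub>B (star (v j) * d))) x)
          * e\<^sub>A * \<iota>\<^sub>C (star c))"
    by (simp add: morita_embedding_def Y1.lip_sum_left lip_elementary EX_mem x)
  also have "\<dots> = \<iota>\<^sub>C (\<Sum>i<n. u i * lip Y (\<Sum>j<m. ract Y (?x i j) (E\<^sub>B (star (v j) * d))) x)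
      * e\<^sub>A * \<iota>\<^sub>C (star c)"
    by (simp add: clinear_sum[OF C1.linear] sum_distrib_right sum_distrib_left lip_sum_left)
  also have "(\<Sum>i<n. u i * lip Y (\<Sum>j<m. ract Y (?x i j) (E\<^sub>B (star (v j) * d))) x)
      = (\<Sum>i<n. u i * E\<^sub>A (star (u i) * lip Y (ract Y y d) x))"
    by (simp only: sum_ract_EX[OF v]) (simp add: lact_ract lip_lact x flip: EX.exp_lip)
  finally show ?thesis
    by (simp add: quasi_basis_left[OF u] lip_ract)
qed

lemma rip_elementary_embedding:
  assumes x: "x \<in> X"
  shows "rip Y1 (t (s c x) (Dual d)) (\<phi> y) = \<iota>\<^sub>D d * e\<^sub>B * \<iota>\<^sub>D (rip Y (lact Y c x) y)"
proof -
  let ?x = "\<lambda>i j. E\<^sub>X (lact Y (star (u i)) (ract Y y (v j)))"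
  have "rip Y1 (t (s c x) (Dual d)) (\<phi> y)
      = (\<Sum>i<n. \<Sum>j<m. \<iota>\<^sub>D d * e\<^sub>B
          * \<iota>\<^sub>D (rip Y x (lact Y (E\<^sub>A (star c * u i)) (?x i j)) * star (v j)))"
    by (simp add: morita_embedding_def Y1.rip_sum_right rip_elementary EX_mem x lact_ract)
  also have "\<dots> = (\<Sum>j<m. \<Sum>i<n. \<iota>\<^sub>D d * e\<^sub>B
          * \<iota>\<^sub>D (rip Y x (lact Y (E\<^sub>A (star c * u i)) (?x i j)) * star (v j)))"
    by (rule sum.swap)
  also have "\<dots> = \<iota>\<^sub>D d * e\<^sub>B
      * \<iota>\<^sub>D (\<Sum>j<m. rip Y x (\<Sum>i<n. lact Y (E\<^sub>A (star c * u i)) (?x i j)) * star (v j))"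
    by (simp add: clinear_sum[OF D1.linear] sum_distrib_right sum_distrib_left rip_sum_right)
  also have "(\<Sum>j<m. rip Y x (\<Sum>i<n. lact Y (E\<^sub>A (star c * u i)) (?x i j)) * star (v j))
      = (\<Sum>j<m. E\<^sub>B (rip Y x (lact Y (star c) y) * v j) * star (v j))"
    by (simp only: sum_lact_EX[OF u]) (simp add: exp_rip_right x rip_ract flip: lact_ract)
  finally show ?thesis
    by (simp add: quasi_basis_right[OF v] rip_lact)
qed

lemma lip_embedding: "lip Y1 (\<phi> y) (\<phi> z) = \<iota>\<^sub>C (lip Y y z)"
proof -
  let ?z = "\<lambda>i j. E\<^sub>X (ract Y (lact Y (star (u i)) z) (v j))"
  have "lip Y1 (\<phi> y) (\<phi> z)
      = (\<Sum>i<n. \<Sum>j<m. \<iota>\<^sub>C (lip Y y (ract Y (?z i j) (star (v j)))) * e\<^sub>A * \<iota>\<^sub>C (star (u i)))"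
    by (subst (2) morita_embedding_def)
      (simp add: Y1.lip_sum_right lip_embedding_elementary EX_mem)
  also have "\<dots> = (\<Sum>i<n. \<iota>\<^sub>C (lip Y y (\<Sum>j<m. ract Y (?z i j) (star (v j))))
      * e\<^sub>A * \<iota>\<^sub>C (star (u i)))"
    by (simp add: clinear_sum[OF C1.linear] sum_distrib_right lip_sum_right)
  also have "\<dots> = \<iota>\<^sub>C (lip Y y z) * (\<Sum>i<n. \<iota>\<^sub>C (u i) * e\<^sub>A * \<iota>\<^sub>C (star (u i)))"
    by (simp add: ract_reconstruction[OF v] lip_lact_right star_star C1.mult
        sum_distrib_left mult.assoc)
  finally show ?thesis
    by (simp add: C1.quasi_basis_unit[OF u])
qed

lemma rip_embedding: "rip Y1 (\<phi> y) (\<phi> z) = \<iota>\<^sub>D (rip Y y z)"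
proof -
  let ?y = "\<lambda>i j. E\<^sub>X (lact Y (star (u i)) (ract Y y (v j)))"
  have "rip Y1 (\<phi> y) (\<phi> z) = (\<Sum>i<n. \<Sum>j<m. \<iota>\<^sub>D (v j) * e\<^sub>B * \<iota>\<^sub>D (rip Y (lact Y (u i) (?y i j)) z))"
    by (subst (1) morita_embedding_def)
      (simp add: Y1.rip_sum_left rip_elementary_embedding EX_mem lact_ract)
  also have "\<dots> = (\<Sum>j<m. \<Sum>i<n. \<iota>\<^sub>D (v j) * e\<^sub>B * \<iota>\<^sub>D (rip Y (lact Y (u i) (?y i j)) z))"
    by (rule sum.swap)
  also have "\<dots> = (\<Sum>j<m. \<iota>\<^sub>D (v j) * e\<^sub>B * \<iota>\<^sub>D (rip Y (\<Sum>i<n. lact Y (u i) (?y i j)) z))"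
    by (simp add: clinear_sum[OF D1.linear] sum_distrib_left rip_sum_left)
  also have "\<dots> = (\<Sum>j<m. \<iota>\<^sub>D (v j) * e\<^sub>B * \<iota>\<^sub>D (star (v j))) * \<iota>\<^sub>D (rip Y y z)"
    by (simp add: lact_reconstruction[OF u] rip_ract_left D1.mult sum_distrib_right mult.assoc)
  finally show ?thesis
    by (simp add: D1.quasi_basis_unit[OF v])
qed

end

theorem corollary6p3:
  fixes A :: "'c::unital_cstar_algebra set" and B :: "'d::unital_cstar_algebra set"
    and X :: "'y::complex_banach set" and Y :: "('c, 'd, 'y) bimod"
    and E\<^sub>A :: "'c \<Rightarrow> 'c" and E\<^sub>B :: "'d \<Rightarrow> 'd" and E\<^sub>X :: "'y \<Rightarrow> 'y"
    and n m :: nat and u :: "nat \<Rightarrow> 'c" and v :: "nat \<Rightarrow> 'd"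
    and \<iota>\<^sub>C :: "'c \<Rightarrow> 'c1::unital_cstar_algebra" and e\<^sub>A :: 'c1 and act\<^sub>C :: "'c1 \<Rightarrow> 'c \<Rightarrow> 'c"
    and \<iota>\<^sub>D :: "'d \<Rightarrow> 'd1::unital_cstar_algebra" and e\<^sub>B :: 'd1 and act\<^sub>D :: "'d1 \<Rightarrow> 'd \<Rightarrow> 'd"
    and CX :: "('c1, 'd, 'cx::complex_banach) bimod" and s :: "'c \<Rightarrow> 'y \<Rightarrow> 'cx"
    and Y1 :: "('c1, 'd1, 'y1::complex_banach) bimod" and t :: "'cx \<Rightarrow> 'd dual \<Rightarrow> 'y1"
  assumes "strongly_morita_equivalent A B X Y"
    and "conditional_expectation A E\<^sub>A" and "index_finite E\<^sub>A"
    and "conditional_expectation B E\<^sub>B" and "index_finite E\<^sub>B"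
    and "bimodule_conditional_expectation A B X Y E\<^sub>A E\<^sub>B E\<^sub>X"
    and "basic_construction \<iota>\<^sub>C E\<^sub>A e\<^sub>A act\<^sub>C"
    and "basic_construction \<iota>\<^sub>D E\<^sub>B e\<^sub>B act\<^sub>D"
    and "bimodule_tensor UNIV B CX A UNIV (basic_bimodule \<iota>\<^sub>C E\<^sub>A e\<^sub>A act\<^sub>C) X Y s"
    and "bimodule_tensor UNIV UNIV Y1 B UNIV CX
           UNIV (dual_bimodule (basic_bimodule \<iota>\<^sub>D E\<^sub>B e\<^sub>B act\<^sub>D)) t"
    and "quasi_basis E\<^sub>A n u" and "quasi_basis E\<^sub>B m v"
  shows "strongly_morita_equivalent (range \<iota>\<^sub>C) (range \<iota>\<^sub>D)
           (range (morita_embedding Y E\<^sub>X n u m v s t)) Y1"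
proof -
  interpret morita_basic_construction A B X Y E\<^sub>A E\<^sub>B E\<^sub>X \<iota>\<^sub>C e\<^sub>A act\<^sub>C \<iota>\<^sub>D e\<^sub>B act\<^sub>D CX s Y1 t n m u v
    using assms by (intro morita_basic_construction.intro morita_conditional_expectation.intro
        morita_basic_construction_axioms.intro)
  show ?thesis
    using lip_embedding rip_embedding
    by (intro strongly_morita_equivalent_range) unfold_locales
qed

end
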